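(* Let $d\ge 3$ and let $\mathcal P$ be a $(d-2)$-polytope such that no $(d-2)$-polytope projectively equivalent to $\mathcal P$ is (strongly) $(0,d-3)$-scribed. Then every $d$-polytope that is a stamp for $\mathcal P$ is not (strongly) $(0,d-3)$-scribable.
   Context: For an integer $e\ge 1$ let $\mathbb S^e=\{x\in\mathbb R^{e+1}:\|x\|_2=1\}$, with coordinates $x_0,\dots,x_e$. A spherical polytope is an intersection of finitely many closed hemispheres of $\mathbb S^e$ containing no two antipodal points; equivalently, $\mathcal P=\mathcal K\cap\mathbb S^e$ for a pointed polyhedral cone $\mathcal K\subset\mathbb R^{e+1}$. Its $k$-faces are the intersections with $\mathbb S^e$ of the $(k+1)$-dimensional faces of $\mathcal K$. An $e$-polytope is a polytope of dimension $e$. A realization of an $e$-polytope is a spherical $e$-polytope in $\mathbb S^e$ with isomorphic face lattice. Two polytopes are projectively equivalent if a projective transformation maps one to the other (a linear isomorphism between the spans of the corresponding cones mapping one cone onto the other). A Euclidean polytope is regarded as a spherical one via the cone $\{(\lambda,\lambda x):x\in\mathcal P,\lambda\ge 0\}$. In $\mathbb S^e$ let $\mathcal B=\{x: x_0\ge 0,\ -x_0^2+x_1^2+\dots+x_e^2\le 0\}$ and $\mathcal S=\partial\mathcal B$. A supporting hyperplane of $\mathcal P$ is a hyperplane $H$ of $\mathbb S^e$ meeting $\mathcal P$ and such that $\mathcal P$ lies in one of the two closed hemispheres bounded by $H$, denoted $H^-$. A proper face $F$ strongly cuts $\mathcal S$ if $\operatorname{relint}(F)\cap\mathcal B\ne\emptyset$;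 it strongly avoids $\mathcal S$ if there is a supporting hyperplane $H$ of $\mathcal P$ with $F=H\cap\mathcal P$ and $\mathcal B\subset H^-$. For $0\le i\le j\le e-1$, an $e$-polytope is (strongly) $(i,j)$-scribed if every $i$-face strongly avoids $\mathcal S$ and every $j$-face strongly cuts $\mathcal S$; it is (strongly) $(i,j)$-scribable if it has a strongly $(i,j)$-scribed realization. A stamp for an $e$-polytope $\mathcal P$ is an $(e+2)$-polytope $\widehat{\mathcal P}$ with a face $F$ such that in every realization of $\widehat{\mathcal P}$ the face corresponding to $F$ is projectively equivalent to $\mathcal P$. *)

theory Defs
  imports "HOL-Analysis.Analysis"
begin

text \<open>
  The unit sphere of a Euclidean space of dimension \<open>e + 1\<close> plays the role of the sphere
  of dimension \<open>e\<close>. The polyhedral cone over a spherical polytope \<open>P\<close> is \<open>conic hull P\<close>.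
\<close>

definition closed_hemisphere :: "'a::euclidean_space \<Rightarrow> 'a set" where
  "closed_hemisphere a = {x \<in> sphere 0 1. a \<bullet> x \<le> 0}"

definition spherical_polytope :: "'a::euclidean_space set \<Rightarrow> bool" where
  "spherical_polytope P \<longleftrightarrow>
     (\<exists>A. finite A \<and> 0 \<notin> A \<and> P = sphere 0 1 \<inter> (\<Inter>a\<in>A. closed_hemisphere a)) \<and>
     \<not> (\<exists>x\<in>P. - x \<in> P)"

text \<open>
  The ambient sphere may have dimension larger than \<open>e\<close>. Here \<open>dim\<close> is the dimension of the
  linear span.
\<close>

definition spherical_polytope_of_dim :: "nat \<Rightarrow> 'a::euclidean_space set \<Rightarrow> bool" where
  "spherical_polytope_of_dim e P \<longleftrightarrow> spherical_polytope P \<and> dim (conic hull P) = e + 1"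

text \<open>
  The faces include the empty face and \<open>P\<close> itself; \<open>{}\<close> and \<open>{0}\<close>, as faces of the cone,
  both give the empty face.
\<close>

definition spherical_face :: "'a::euclidean_space set \<Rightarrow> 'a set \<Rightarrow> bool" where
  "spherical_face F P \<longleftrightarrow> (\<exists>G. G face_of conic hull P \<and> F = G \<inter> sphere 0 1)"

definition spherical_k_face :: "nat \<Rightarrow> 'a::euclidean_space set \<Rightarrow> 'a set \<Rightarrow> bool" where
  "spherical_k_face k F P \<longleftrightarrow>
     (\<exists>G. G face_of conic hull P \<and> dim G = k + 1 \<and> F = G \<inter> sphere 0 1)"

definition face_lattice_isomorphism ::
    "('a::euclidean_space set \<Rightarrow> 'b::euclidean_space set) \<Rightarrow> 'a set \<Rightarrow> 'b set \<Rightarrow> bool" where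
  "face_lattice_isomorphism \<phi> P Q \<longleftrightarrow>
     bij_betw \<phi> {F. spherical_face F P} {F. spherical_face F Q} \<and>
     (\<forall>F G. spherical_face F P \<longrightarrow> spherical_face G P \<longrightarrow> (\<phi> F \<subseteq> \<phi> G \<longleftrightarrow> F \<subseteq> G))"

text \<open>
  \<open>realization_via e \<phi> Q P\<close>: \<open>Q\<close> is a realization, in the sphere of dimension \<open>e\<close>, of the
  \<open>e\<close>-polytope \<open>P\<close>, and under \<open>\<phi>\<close> the face \<open>F\<close> of \<open>P\<close> corresponds to the face \<open>\<phi> F\<close> of \<open>Q\<close>.
\<close>

definition realization_via ::
    "nat \<Rightarrow> ('a::euclidean_space set \<Rightarrow> 'b::euclidean_space set) \<Rightarrow> 'b set \<Rightarrow> 'a set \<Rightarrow> bool" where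
  "realization_via e \<phi> Q P \<longleftrightarrow>
     DIM('b) = e + 1 \<and> spherical_polytope_of_dim e P \<and> spherical_polytope_of_dim e Q \<and>
     face_lattice_isomorphism \<phi> P Q"

definition projectively_equivalent ::
    "'a::euclidean_space set \<Rightarrow> 'b::euclidean_space set \<Rightarrow> bool" where
  "projectively_equivalent P Q \<longleftrightarrow>
     (\<exists>f. linear f \<and> bij_betw f (span (conic hull P)) (span (conic hull Q)) \<and>
          f ` (conic hull P) = conic hull Q)"

text \<open>
  For the notions involving the ball, the coordinate \<open>x\<^sub>0\<close> is singled out by taking
  \<open>real \<times> 'a\<close> as the ambient space, with \<open>DIM('a) = e\<close>: \<open>fst x\<close> is \<open>x\<^sub>0\<close>, and
  \<open>(norm (snd x))\<^sup>2\<close> is \<open>x\<^sub>1\<^sup>2 + \<dots> + x\<^sub>e\<^sup>2\<close>.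
\<close>

definition spherical_ball :: "(real \<times> 'a::euclidean_space) set" where
  "spherical_ball = {x \<in> sphere 0 1. fst x \<ge> 0 \<and> - (fst x)\<^sup>2 + (norm (snd x))\<^sup>2 \<le> 0}"

text \<open>
  The relative interior has to be taken in the great subsphere spanned by \<open>F\<close>, hence via the
  cone: \<open>rel_interior F\<close> would refer to the affine hull of \<open>F\<close> in the ambient vector space.
\<close>

definition spherical_relint :: "'a::euclidean_space set \<Rightarrow> 'a set" where
  "spherical_relint F = rel_interior (conic hull F) \<inter> sphere 0 1"

definition strongly_cuts :: "(real \<times> 'a::euclidean_space) set \<Rightarrow> bool" where
  "strongly_cuts F \<longleftrightarrow> spherical_relint F \<inter> spherical_ball \<noteq> {}"

text \<open>
  The supporting hyperplane \<open>H\<close> is the set of all \<open>x\<close> in the sphere with \<open>a \<bullet> x = 0\<close>, with \<open>a\<close>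
  oriented such that \<open>closed_hemisphere a\<close> is the side of \<open>H\<close> containing \<open>P\<close>.
\<close>

definition strongly_avoids ::
    "(real \<times> 'a::euclidean_space) set \<Rightarrow> (real \<times> 'a) set \<Rightarrow> bool" where
  "strongly_avoids F P \<longleftrightarrow>
     (\<exists>a H. a \<noteq> 0 \<and> H = {x \<in> sphere 0 1. a \<bullet> x = 0} \<and> H \<inter> P \<noteq> {} \<and>
          P \<subseteq> closed_hemisphere a \<and> F = H \<inter> P \<and> spherical_ball \<subseteq> closed_hemisphere a)"

text \<open>For \<open>i \<le> j < DIM('a)\<close>.\<close>

definition strongly_scribed ::
    "nat \<Rightarrow> nat \<Rightarrow> (real \<times> 'a::euclidean_space) set \<Rightarrow> bool" where
  "strongly_scribed i j P \<longleftrightarrow>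
     spherical_polytope_of_dim DIM('a) P \<and>
     (\<forall>F. spherical_k_face i F P \<longrightarrow> strongly_avoids F P) \<and>
     (\<forall>F. spherical_k_face j F P \<longrightarrow> strongly_cuts F)"

text \<open>
  In the next two definitions, realizations live in the unit sphere of \<open>real \<times> 'b\<close>. The
  dimension of the polytope realized (\<open>P\<close>, respectively \<open>R\<close>) must therefore be \<open>DIM('b)\<close>,
  but its own ambient space is arbitrary.
\<close>

definition strongly_scribable ::
    "'b::euclidean_space itself \<Rightarrow> nat \<Rightarrow> nat \<Rightarrow> 'a::euclidean_space set \<Rightarrow> bool" where
  "strongly_scribable _ i j P \<longleftrightarrow>
     (\<exists>\<phi> (Q :: (real \<times> 'b) set). realization_via DIM('b) \<phi> Q P \<and> strongly_scribed i j Q)"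

text \<open>
  \<open>stamp TYPE('b) e R P\<close>: the \<open>(e + 2)\<close>-polytope \<open>R\<close> is a stamp for the \<open>e\<close>-polytope \<open>P\<close>.
  The condition is imposed on each realization together with each identification
  \<open>\<phi>\<close> of its face lattice with that of \<open>R\<close>.
\<close>

definition stamp ::
    "'b::euclidean_space itself \<Rightarrow> nat \<Rightarrow> 'q::euclidean_space set \<Rightarrow> 'p::euclidean_space set \<Rightarrow> bool"
  where
  "stamp _ e R P \<longleftrightarrow>
     spherical_polytope_of_dim e P \<and> spherical_polytope_of_dim (e + 2) R \<and>
     (\<exists>F. spherical_face F R \<and>
        (\<forall>\<phi> (Q :: (real \<times> 'b) set).
           realization_via (e + 2) \<phi> Q R \<longrightarrow> projectively_equivalent (\<phi> F) P))"

end

theory Submission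
  imports Defs
begin

text \<open>
  Let \<open>G\<close> be the cone over the face of a scribed realization that corresponds to the
  distinguished face of the stamp, and let \<open>L = span G\<close>. Two distinct facets of \<open>G\<close> contain
  points of the light cone in their relative interiors, so \<open>L\<close> is not tangent to the light cone
  and meets its interior. Hence \<open>L\<close> carries a Lorentzian form, and some linear isomorphism maps
  the standard Lorentz space of the same dimension onto \<open>L\<close> and light cone onto light cone. Its
  inverse carries \<open>G\<close> to a cone over a polytope projectively equivalent to \<open>P\<close>. Cutting faces
  are faces of the large polytope as well, and avoiding hyperplanes are restricted to \<open>L\<close>; so
  this polytope is scribed in the same way.
\<close>

section \<open>The light cone, and cones over subsets of the unit sphere\<close>

definition light_cone :: "(real \<times> 'a::euclidean_space) set" where
  "light_cone = {x. norm (snd x) \<le> fst x}"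

lemma conic_light_cone: "conic light_cone"
  by (auto simp: conic_def light_cone_def mult_left_mono)

lemma spherical_ball_eq: "spherical_ball = light_cone \<inter> sphere 0 1"
proof -
  have "fst x \<ge> 0 \<and> - (fst x)\<^sup>2 + (norm (snd x))\<^sup>2 \<le> 0 \<longleftrightarrow> norm (snd x) \<le> fst x"
    for x :: "real \<times> 'a"
    by (smt (verit) norm_ge_zero power2_le_imp_le power_mono)
  then show ?thesis
    by (auto simp: spherical_ball_def light_cone_def)
qed

text \<open>The full norm replaces \<open>norm (snd x)\<close> because an orthogonal decomposition
  gives direct access to the full norm and to the first coordinate of a vector, but not to its
  second component.\<close>

lemma in_light_cone_iff:
  "x \<in> light_cone \<longleftrightarrow> fst x \<ge> 0 \<and> (norm x)\<^sup>2 \<le> 2 * (fst x)\<^sup>2"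
proof -
  have "(norm x)\<^sup>2 = (fst x)\<^sup>2 + (norm (snd x))\<^sup>2"
    by (simp add: norm_prod_def)
  then show ?thesis
    unfolding light_cone_def mem_Collect_eq
    by (smt (verit) norm_ge_zero power2_le_imp_le power_mono)
qed

lemma conic_sgn_iff:
  fixes x :: "'a::real_normed_vector"
  assumes "conic S" "x \<noteq> 0"
  shows "sgn x \<in> S \<longleftrightarrow> x \<in> S"
proof
  assume "sgn x \<in> S"
  then have "norm x *\<^sub>R sgn x \<in> S" using assms(1) by (simp add: conicD)
  then show "x \<in> S" using assms(2) by (simp add: sgn_div_norm)
next
  assume "x \<in> S"
  then show "sgn x \<in> S" using assms(1) by (simp add: sgn_div_norm conicD)
qed

text \<open>Every nonzero point is a multiple of its normalization. The cone \<open>{0}\<close> is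
  excluded because it misses the sphere, so that the hull would be empty; the origin is recovered as
  a zero multiple of some unit vector.\<close>

lemma conic_hull_Int_sphere:
  fixes S :: "'a::real_normed_vector set"
  assumes "conic S" "\<not> S \<subseteq> {0}"
  shows "conic hull (S \<inter> sphere 0 1) = S"
proof
  show "conic hull (S \<inter> sphere 0 1) \<subseteq> S"
    using assms(1) by (simp add: hull_minimal)
  show "S \<subseteq> conic hull (S \<inter> sphere 0 1)"
  proof
    obtain z where z: "z \<in> S" "z \<noteq> 0" using assms(2) by auto
    fix x assume x: "x \<in> S"
    show "x \<in> conic hull (S \<inter> sphere 0 1)"
    proof (cases "x = 0")
      case True
      have "sgn z \<in> S \<inter> sphere 0 1" using z assms(1) by (simp add: conic_sgn_iff norm_sgn)
      then have "0 *\<^sub>R sgn z \<in> conic hull (S \<inter> sphere 0 1)"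
        unfolding conic_hull_explicit by blast
      then show ?thesis using True by simp
    next
      case False
      then have "sgn x \<in> S \<inter> sphere 0 1" using x assms(1) by (simp add: conic_sgn_iff norm_sgn)
      then have "norm x *\<^sub>R sgn x \<in> conic hull (S \<inter> sphere 0 1)"
        unfolding conic_hull_explicit using norm_ge_zero by blast
      then show ?thesis using False by (simp add: sgn_div_norm)
    qed
  qed
qed

text \<open>Scaling by \<open>c\<close> is an injective linear map carrying the cone onto itself, so
  it preserves the relative interior.\<close>

lemma conic_rel_interior_scaleR:
  fixes S :: "'a::euclidean_space set"
  assumes "conic S" "x \<in> rel_interior S" "c > 0"
  shows "c *\<^sub>R x \<in> rel_interior S"
proof -
  have "(*\<^sub>R) c ` S = S"
  proof
    show "(*\<^sub>R) c ` S \<subseteq> S" using assms by (auto simp: conicD)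
    show "S \<subseteq> (*\<^sub>R) c ` S"
    proof
      fix y assume "y \<in> S"
      then have "inverse c *\<^sub>R y \<in> S" using assms by (simp add: conicD)
      then show "y \<in> (*\<^sub>R) c ` S" using assms(3) by (auto intro!: image_eqI[of _ _ "inverse c *\<^sub>R y"])
    qed
  qed
  moreover have "inj ((*\<^sub>R) c :: 'a \<Rightarrow> 'a)" using assms(3) by (auto intro: injI)
  ultimately have "rel_interior S = (*\<^sub>R) c ` rel_interior S"
    using rel_interior_injective_linear_image[of "(*\<^sub>R) c" S] bounded_linear_scaleR_right by metis
  then show ?thesis using assms(2) by blast
qed

section \<open>Polyhedral cones over spherical polytopes, and their facets\<close>

text \<open>The normals defining the hemispheres also define the cone by homogeneity, and a nonzero
  vector in the cone with its negative would normalize to an antipodal pair.\<close>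

lemma spherical_polytope_cone:
  assumes "spherical_polytope P" "P \<noteq> {}"
  obtains A where "finite A" "conic hull P = {x. \<forall>a\<in>A. a \<bullet> x \<le> 0}"
    and "\<forall>x\<in>conic hull P. - x \<in> conic hull P \<longrightarrow> x = 0"
proof -
  obtain A where A: "finite A" "P = sphere 0 1 \<inter> (\<Inter>a\<in>A. closed_hemisphere a)"
    and antipodal: "\<not> (\<exists>x\<in>P. - x \<in> P)"
    using assms(1) unfolding spherical_polytope_def by blast
  let ?K = "{x. \<forall>a\<in>A. a \<bullet> x \<le> 0}"
  have P: "P = ?K \<inter> sphere 0 1"
    using A(2) by (auto simp: closed_hemisphere_def)
  have con: "conic ?K"
    by (auto simp: conic_def mult_nonneg_nonpos)
  have "\<not> ?K \<subseteq> {0}"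
    using P assms(2) by auto
  then have K: "conic hull P = ?K"
    using conic_hull_Int_sphere[OF con] P by simp
  have "x = 0" if "x \<in> ?K" "- x \<in> ?K" for x
  proof (rule ccontr)
    assume "x \<noteq> 0"
    then have "sgn x \<in> P" "- sgn x \<in> P"
      using that conic_sgn_iff[OF con, of x] conic_sgn_iff[OF con, of "- x"]
      by (auto simp: P norm_sgn sgn_minus)
    then show False using antipodal by blast
  qed
  with that A(1) K show ?thesis by auto
qed

lemma polyhedron_halfspaces_at_0:
  fixes A :: "'a::euclidean_space set"
  assumes "finite A"
  shows "polyhedron {x. \<forall>a\<in>A. a \<bullet> x \<le> 0}"
proof -
  have "{x. \<forall>a\<in>A. a \<bullet> x \<le> 0} = \<Inter>((\<lambda>a. {x. a \<bullet> x \<le> 0}) ` A)" by auto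
  then show ?thesis using assms by (auto simp: polyhedron_halfspace_le)
qed

text \<open>
  The face \<open>{0}\<close> is the intersection of the facets containing it, and it is not itself a facet.
\<close>

lemma pointed_cone_two_facets:
  fixes G :: "'a::euclidean_space set"
  assumes "polyhedron G" "conic G" "dim G \<ge> 2"
    and pointed: "\<And>x. x \<in> G \<Longrightarrow> - x \<in> G \<Longrightarrow> x = 0"
  obtains F1 F2 where "F1 face_of G" "F2 face_of G" "F1 \<noteq> F2"
    "dim F1 = dim G - 1" "dim F2 = dim G - 1"
proof -
  have ne: "G \<noteq> {0}" "G \<noteq> {}" using assms(3) by auto
  have G0: "0 \<in> G" using assms(2) ne by (simp add: conic_contains_0)
  have face0: "{0} face_of G"
  proof (subst face_of_singleton, unfold extreme_point_of_def, intro conjI ballI notI)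
    show "0 \<in> G" by fact
    fix a b assume ab: "a \<in> G" "b \<in> G" "0 \<in> open_segment a b"
    then obtain u where u: "0 < u" "u < 1" "0 = (1 - u) *\<^sub>R a + u *\<^sub>R b" "a \<noteq> b"
      by (auto simp: in_segment)
    \<comment> \<open>The origin strictly inside a segment makes positive multiples of its endpoints
      opposite points of \<open>G\<close>, against pointedness.\<close>
    have *: "- ((1 - u) *\<^sub>R a) = u *\<^sub>R b" using u(3) by (simp add: add_eq_0_iff)
    have "(1 - u) *\<^sub>R a \<in> G" "u *\<^sub>R b \<in> G" using ab u assms(2) by (auto simp: conicD)
    then have "(1 - u) *\<^sub>R a = 0" using pointed * by metis
    then show False using u * by auto
  qed
  let ?H = "{F. F facet_of G \<and> {0} \<subseteq> F}"
  have inter: "{0} = \<Inter>?H"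
    using face_of_polyhedron[OF assms(1) face0] ne by auto
  have facet: "F face_of G \<and> dim F = dim G - 1" if "F \<in> ?H" for F
  proof -
    \<comment> \<open>Both sets contain the origin, so affine and linear dimension agree and
      \<open>facet_of\<close> can be read linearly.\<close>
    have "aff_dim F = int (dim F)" "aff_dim G = int (dim G)"
      using that G0 by (auto intro!: aff_dim_zero hull_inc)
    then show ?thesis using that by (auto simp: facet_of_def)
  qed
  have "?H \<noteq> {}"
  proof
    \<comment> \<open>The empty intersection is \<open>UNIV\<close>, not \<open>G\<close>, so this
      case needs its own contradiction.\<close>
    assume "?H = {}"
    then have "{0} = (UNIV :: 'a set)" using inter by (simp only: Inter_empty)
    then show False using ne by blast
  qed
  then obtain F1 where F1: "F1 \<in> ?H" by blast
  \<comment> \<open>A single facet through the origin would be the whole intersection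
    \<open>{0}\<close>, yet facets have dimension at least 1.\<close>
  have "F1 \<noteq> {0}" using facet[OF F1] assms(3) by auto
  then have "?H \<noteq> {F1}" using inter by (metis cInf_singleton)
  then obtain F2 where "F2 \<in> ?H" "F1 \<noteq> F2" using F1 by blast
  then show ?thesis using that facet F1 by metis
qed

section \<open>Lorentzian geometry of the light cone\<close>

text \<open>Without strictness both vectors lie on the boundary and the triangle inequality for
  their second components is an equality. These components are then parallel, and so are the
  vectors.\<close>

lemma light_cone_add_strict:
  assumes "x \<in> light_cone" "y \<in> light_cone" "x \<noteq> 0" "y \<noteq> 0"
    and "\<And>c. c > 0 \<Longrightarrow> y \<noteq> c *\<^sub>R x"
  shows "norm (snd (x + y)) < fst (x + y)"
proof (rule ccontr)
  assume "\<not> ?thesis"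
  then have eq: "norm (snd x + snd y) = norm (snd x) + norm (snd y)"
    and nx: "norm (snd x) = fst x" and ny: "norm (snd y) = fst y"
    using assms(1,2) norm_triangle_ineq[of "snd x" "snd y"] by (auto simp: light_cone_def)
  have px: "fst x > 0" and py: "fst y > 0"
    using nx ny assms(3,4) by (metis norm_ge_zero less_eq_real_def norm_eq_zero prod_eq_iff
        fst_zero snd_zero)+
  have "fst x *\<^sub>R snd y = fst y *\<^sub>R snd x"
    using eq nx ny norm_triangle_eq by metis
  then have "fst x *\<^sub>R y = fst y *\<^sub>R x"
    by (simp add: prod_eq_iff)
  then have "inverse (fst x) *\<^sub>R (fst x *\<^sub>R y) = inverse (fst x) *\<^sub>R (fst y *\<^sub>R x)"
    by simp
  then have "y = (fst y / fst x) *\<^sub>R x"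
    using px by (simp add: field_simps)
  then show False using assms(5) px py by (metis divide_pos_pos)
qed

text \<open>
  In the proof, \<open>n\<close> is the orthogonal projection of \<open>(1, 0)\<close> to \<open>L\<close>, so that \<open>fst x = n \<bullet> x\<close> on
  \<open>L\<close>, and the multiple \<open>m\<close> of \<open>n\<close> is normalized by \<open>2 * (fst m)\<^sup>2 - (norm m)\<^sup>2 = 1\<close>.
\<close>

lemma lorentzian_parametrization:
  fixes L :: "(real \<times> 'b::euclidean_space) set"
  assumes L: "subspace L" "dim L = DIM('a::euclidean_space) + 1"
    and u: "u \<in> L" "norm (snd u) < fst u"
  obtains g :: "real \<times> 'a::euclidean_space \<Rightarrow> real \<times> 'b" where "linear g" "inj g" "range g = L"
    "\<And>y. g y \<in> light_cone \<longleftrightarrow> y \<in> light_cone"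
proof -
  obtain n z where nz: "n \<in> span L" "\<And>w. w \<in> span L \<Longrightarrow> orthogonal z w"
      "(1, 0) = n + z"
    using orthogonal_subspace_decomp_exists[of L "(1, 0)"] by metis
  have nL: "n \<in> L" using nz L by (simp add: span_eq_iff[THEN iffD2])
  have fst_eq: "fst x = n \<bullet> x" if "x \<in> L" for x
  proof -
    have "fst x = (1, 0) \<bullet> x" by (simp add: inner_prod_def)
    also have "\<dots> = n \<bullet> x"
      using nz(2)[of x] that by (simp add: nz(3) inner_add_left orthogonal_def span_base)
    finally show ?thesis .
  qed
  have fn: "fst n = (norm n)\<^sup>2" using fst_eq[OF nL] by (simp add: power2_norm_eq_inner)
  have u0: "fst u > 0" using u(2) by (smt (verit) norm_ge_zero)
  have n0: "norm n > 0" using fst_eq[OF u(1)] u0 by auto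
  \<comment> \<open>The vector \<open>u\<close> inside the light cone and Cauchy-Schwarz force
    \<open>2 * (norm n)\<^sup>2 > 1\<close>, which makes \<open>n\<close> timelike.\<close>
  have "(norm u)\<^sup>2 < 2 * (fst u)\<^sup>2"
    using power_strict_mono[OF u(2), of 2] by (simp add: norm_prod_def)
  also have "(fst u)\<^sup>2 \<le> (norm n)\<^sup>2 * (norm u)\<^sup>2"
    using fst_eq[OF u(1)] Cauchy_Schwarz_ineq[of n u] by (simp add: power2_norm_eq_inner)
  finally have "(norm u)\<^sup>2 * 1 < (norm u)\<^sup>2 * (2 * (norm n)\<^sup>2)"
    by (simp add: mult.left_commute mult.commute)
  then have k: "2 * (norm n)\<^sup>2 - 1 > 0"
    using mult_left_less_imp_less[of "(norm u)\<^sup>2" 1 "2 * (norm n)\<^sup>2"] by simp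
  \<comment> \<open>Since \<open>fst n = (norm n)\<^sup>2\<close>, the quantity
    \<open>2 * (fst n)\<^sup>2 - (norm n)\<^sup>2\<close> factors as
    \<open>(norm n)\<^sup>2 * (2 * (norm n)\<^sup>2 - 1)\<close>; \<open>c\<close> is the reciprocal
    of its square root.\<close>
  define c where "c = 1 / (norm n * sqrt (2 * (norm n)\<^sup>2 - 1))"
  have c0: "c > 0" using k n0 by (simp add: c_def)
  have c2: "c\<^sup>2 * ((norm n)\<^sup>2 * (2 * (norm n)\<^sup>2 - 1)) = 1"
    using k n0 by (simp add: c_def power_mult_distrib power_divide)
  define m where "m = c *\<^sub>R n"
  have mL: "m \<in> L" using nL L by (simp add: m_def subspace_scale)
  have fm: "fst m > 0" using c0 n0 by (simp add: m_def fn)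
  have m1: "2 * (fst m)\<^sup>2 = (norm m)\<^sup>2 + 1"
    using c2 by (simp add: m_def fn power_mult_distrib algebra_simps)
  \<comment> \<open>The orthogonal complement of \<open>n\<close> in \<open>L\<close>. There
    \<open>fst\<close> vanishes, so the Lorentzian form is the Euclidean one and an isometry with
    \<open>'a\<close> preserves it.\<close>
  define L0 where "L0 = {y \<in> L. \<forall>x\<in>span {n}. orthogonal x y}"
  have subL0: "subspace L0"
    using L(1) by (auto simp: L0_def subspace_def orthogonal_def inner_add_right)
  have "dim L0 + dim (span {n}) = dim L"
    unfolding L0_def
    using L(1) nL by (intro dim_subspace_orthogonal_to_vectors) (auto simp: span_minimal)
  moreover have "dim (span {n}) = 1" using n0 by (auto simp: dim_singleton)
  ultimately have dimL0: "dim L0 = dim (UNIV :: 'a set)" using L(2) by simp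
  obtain \<iota> :: "'a \<Rightarrow> real \<times> 'b" where \<iota>: "linear \<iota>" "\<iota> ` UNIV = L0" "\<And>x. norm (\<iota> x) = norm x"
    using isometry_subspaces[OF subspace_UNIV subL0 dimL0[symmetric]] by auto
  have \<iota>L: "\<iota> w \<in> L" and \<iota>n: "n \<bullet> \<iota> w = 0" for w
    using \<iota>(2) by (auto simp: L0_def orthogonal_def dest: bspec[OF _ span_base[of n]])
  have f\<iota>: "fst (\<iota> w) = 0" for w using fst_eq[OF \<iota>L] \<iota>n by simp
  \<comment> \<open>The time axis goes to the line of \<open>m\<close>, and space goes isometrically
    to \<open>L0\<close>.\<close>
  define g where "g y = fst y *\<^sub>R m + \<iota> (snd y)" for y
  have lin: "linear g"
    by (rule linearI)
      (simp_all add: g_def linear_add[OF \<iota>(1)] linear_cmul[OF \<iota>(1)] algebra_simps)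
  have fg: "fst (g y) = fst y * fst m" for y by (simp add: g_def f\<iota>)
  have ng: "(norm (g y))\<^sup>2 = (fst y)\<^sup>2 * (norm m)\<^sup>2 + (norm (snd y))\<^sup>2" for y
  proof -
    have "orthogonal (fst y *\<^sub>R m) (\<iota> (snd y))" by (simp add: orthogonal_def m_def \<iota>n)
    then show ?thesis
      by (simp add: g_def norm_add_Pythagorean \<iota>(3) power_mult_distrib)
  qed
  have inj: "inj g"
  proof (subst linear_injective_0[OF lin], intro allI impI)
    fix y assume "g y = 0"
    then have "fst y = 0" "norm (snd y) = 0" using fg[of y] ng[of y] fm by auto
    then show "y = 0" by (simp add: prod_eq_iff)
  qed
  have "range g \<subseteq> L" using mL \<iota>L L(1) by (auto simp: g_def subspace_add subspace_scale)
  moreover have "dim (range g) = dim L"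
    using dim_image_eq[OF lin, of UNIV] inj L(2) by simp
  ultimately have range: "range g = L"
    using subspace_dim_equal[OF linear_subspace_image[OF lin subspace_UNIV] L(1)] by simp
  have "g y \<in> light_cone \<longleftrightarrow> y \<in> light_cone" for y
  proof -
    \<comment> \<open>By the normalization of \<open>m\<close>, the terms with
      \<open>(norm m)\<^sup>2\<close> cancel in \<open>in_light_cone_iff\<close>, leaving the same
      inequality for \<open>g y\<close> as for \<open>y\<close>.\<close>
    have "2 * (fst (g y))\<^sup>2 = (fst y)\<^sup>2 * ((norm m)\<^sup>2 + 1)"
      by (simp add: fg power_mult_distrib m1[symmetric])
    moreover have "(norm y)\<^sup>2 = (fst y)\<^sup>2 + (norm (snd y))\<^sup>2" by (simp add: norm_prod_def)
    moreover have "fst (g y) \<ge> 0 \<longleftrightarrow> fst y \<ge> 0"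
      using fm by (simp add: fg zero_le_mult_iff)
    ultimately show ?thesis
      unfolding in_light_cone_iff ng by (auto simp: algebra_simps)
  qed
  then show ?thesis using that lin inj range by blast
qed

section \<open>Strong cutting and avoiding expressed on cones\<close>

lemma conic_face_of_conic:
  fixes K :: "'a::euclidean_space set"
  assumes "conic K" "G face_of K" "dim G \<ge> 1"
  shows "conic G" "conic hull (G \<inter> sphere 0 1) = G"
proof -
  show c: "conic G" using face_of_conic assms by blast
  have "\<not> G \<subseteq> {0}" using assms(3) by (metis dim_eq_0 not_one_le_zero)
  then show "conic hull (G \<inter> sphere 0 1) = G" using conic_hull_Int_sphere[OF c] by blast
qed

text \<open>Relative interior and light cone are both stable under positive scaling, so any nonzero
  common point can be normalized.\<close>

lemma strongly_cuts_face_iff: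
  assumes "conic K" "G face_of K" "dim G \<ge> 1"
  shows "strongly_cuts (G \<inter> sphere 0 1) \<longleftrightarrow> (\<exists>x\<in>rel_interior G. x \<noteq> 0 \<and> x \<in> light_cone)"
    (is "?L \<longleftrightarrow> ?R")
proof -
  note facts = conic_face_of_conic[OF assms]
  have L: "?L \<longleftrightarrow> (\<exists>x\<in>rel_interior G. norm x = 1 \<and> x \<in> light_cone)"
    by (auto simp: strongly_cuts_def spherical_relint_def spherical_ball_eq facts)
  show ?thesis
  proof
    assume ?R
    then obtain x where x: "x \<in> rel_interior G" "x \<noteq> 0" "x \<in> light_cone" by blast
    have "sgn x \<in> rel_interior G"
      using conic_rel_interior_scaleR[OF facts(1) x(1)] x(2) by (simp add: sgn_div_norm)
    moreover have "sgn x \<in> light_cone" using x conic_sgn_iff[OF conic_light_cone] by blast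
    ultimately show ?L unfolding L using x(2) by (intro bexI[of _ "sgn x"]) (auto simp: norm_sgn)
  next
    assume ?L
    then show ?R unfolding L by (metis norm_zero zero_neq_one)
  qed
qed

text \<open>Normalization transfers each condition from unit vectors to all nonzero ones, and the
  origin satisfies them trivially. The resulting linear functional can be pulled back along a linear
  map.\<close>

lemma strongly_avoids_face_iff:
  assumes "conic K" "G face_of K" "dim G \<ge> 1"
  shows "strongly_avoids (G \<inter> sphere 0 1) (K \<inter> sphere 0 1) \<longleftrightarrow>
    (\<exists>a. a \<noteq> 0 \<and> (\<forall>x\<in>K. a \<bullet> x \<le> 0) \<and> (\<forall>x\<in>light_cone. a \<bullet> x \<le> 0) \<and> G = {x\<in>K. a \<bullet> x = 0})"
    (is "?L \<longleftrightarrow> ?R")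
proof
  note facts = conic_face_of_conic[OF assms]
  have G0: "0 \<in> G" using facts(1) assms(3) by (metis conic_contains_0 dim_empty not_one_le_zero)
  then have K0: "0 \<in> K" using assms(2) face_of_imp_subset by blast
  have sg: "a \<bullet> sgn x \<le> 0 \<longleftrightarrow> a \<bullet> x \<le> 0" "a \<bullet> sgn x = 0 \<longleftrightarrow> a \<bullet> x = 0"
    if "x \<noteq> 0" for a x :: "real \<times> 'a"
    using that by (simp_all add: sgn_div_norm mult_le_0_iff)
  {
    assume ?L
    then obtain a where a: "a \<noteq> 0" "K \<inter> sphere 0 1 \<subseteq> closed_hemisphere a"
      "G \<inter> sphere 0 1 = {x \<in> sphere 0 1. a \<bullet> x = 0} \<inter> (K \<inter> sphere 0 1)"
      "spherical_ball \<subseteq> closed_hemisphere a"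
      unfolding strongly_avoids_def by blast
    have "a \<bullet> x \<le> 0" if "x \<in> K" for x
    proof (cases "x = 0")
      case False
      then have "sgn x \<in> K \<inter> sphere 0 1" using that conic_sgn_iff[OF assms(1)] by (simp add: norm_sgn)
      then have "a \<bullet> sgn x \<le> 0" using a(2) unfolding closed_hemisphere_def by blast
      then show ?thesis using sg(1)[OF False] by blast
    qed simp
    moreover have "a \<bullet> x \<le> 0" if "x \<in> light_cone" for x
    proof (cases "x = 0")
      case False
      then have "sgn x \<in> spherical_ball"
        using that conic_sgn_iff[OF conic_light_cone False] by (simp add: norm_sgn spherical_ball_eq)
      then have "a \<bullet> sgn x \<le> 0" using a(4) unfolding closed_hemisphere_def by blast
      then show ?thesis using sg(1)[OF False] by blast
    qed simp
    moreover have "x \<in> G \<longleftrightarrow> x \<in> K \<and> a \<bullet> x = 0" for x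
    proof (cases "x = 0")
      case False
      have "sgn x \<in> G \<longleftrightarrow> a \<bullet> sgn x = 0 \<and> sgn x \<in> K"
      proof -
        have "sgn x \<in> sphere 0 1" using False by (simp add: norm_sgn)
        then show ?thesis using a(3) by blast
      qed
      then show ?thesis
        using False sg(2) conic_sgn_iff[OF assms(1) False] conic_sgn_iff[OF facts(1) False] by blast
    qed (simp add: G0 K0)
    ultimately show ?R using a(1) by blast
  }
  assume ?R
  then obtain a where a: "a \<noteq> 0" "\<forall>x\<in>K. a \<bullet> x \<le> 0" "\<forall>x\<in>light_cone. a \<bullet> x \<le> 0"
    "G = {x\<in>K. a \<bullet> x = 0}" by blast
  \<comment> \<open>A supporting hyperplane has to meet the polytope, which is why \<open>G\<close>
    must contain a unit vector.\<close>
  have "G \<inter> sphere 0 1 \<noteq> {}"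
    using facts(2) assms(3) by (metis conic_hull_eq_empty dim_empty not_one_le_zero)
  then show ?L
    unfolding strongly_avoids_def
    using a by (intro exI[of _ a]) (auto simp: closed_hemisphere_def spherical_ball_eq)
qed

section \<open>Scribedness inherited by a face in its own span\<close>

text \<open>Faces of the preimage are carried by \<open>g\<close> to faces of \<open>G\<close>,
  hence of the cone over \<open>Q\<close>. Supporting functionals come back through the adjoint of
  \<open>g\<close>, points of the light cone through its inverse on \<open>span G\<close>.\<close>

lemma face_section_scribed:
  fixes Q :: "(real \<times> 'b::euclidean_space) set" and g :: "real \<times> 'a::euclidean_space \<Rightarrow> real \<times> 'b"
  assumes "spherical_polytope Q" "Q \<noteq> {}" and G: "G face_of conic hull Q" "dim G = DIM('a) + 1"
    and "DIM('a) \<ge> 1"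
    and avoid: "\<And>F. spherical_k_face 0 F Q \<Longrightarrow> strongly_avoids F Q"
    and cut: "\<And>F. spherical_k_face j F Q \<Longrightarrow> strongly_cuts F"
    and g: "linear g" "inj g" "range g = span G" "\<And>y. g y \<in> light_cone \<longleftrightarrow> y \<in> light_cone"
  defines "Q' \<equiv> (g -` G) \<inter> sphere 0 1"
  shows "conic hull Q' = g -` G" "strongly_scribed 0 j Q'"
proof -
  obtain A where A: "finite A" "conic hull Q = {x. \<forall>a\<in>A. a \<bullet> x \<le> 0}"
    and pointed: "\<forall>x\<in>conic hull Q. - x \<in> conic hull Q \<longrightarrow> x = 0"
    using spherical_polytope_cone[OF assms(1,2)] by blast
  define K where "K = conic hull Q"
  have conK: "conic K" by (simp add: K_def conic_conic_hull)
  have Q: "Q = K \<inter> sphere 0 1"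
  proof -
    have "Q \<subseteq> sphere 0 1" using assms(1) by (auto simp: spherical_polytope_def)
    moreover have "x \<in> Q" if x: "x \<in> K" "norm x = 1" for x
    proof -
      obtain c y where "0 \<le> c" "y \<in> Q" "x = c *\<^sub>R y"
        using x(1) by (auto simp: K_def conic_hull_explicit)
      moreover from this have "norm y = 1" using \<open>Q \<subseteq> sphere 0 1\<close> by auto
      ultimately show ?thesis using x(2) by simp
    qed
    moreover have "Q \<subseteq> K" by (simp add: K_def hull_subset)
    ultimately show ?thesis unfolding set_eq_iff Int_iff mem_sphere_0
      by (metis mem_sphere_0 subsetD)
  qed
  have convK: "convex K"
    using polyhedron_halfspaces_at_0[OF A(1)] A(2) polyhedron_imp_convex by (metis K_def)
  have GK: "G face_of K" using G(1) by (simp add: K_def)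
  note factsG = conic_face_of_conic[OF conK GK]
  have conG: "conic G" using factsG G(2) by simp
  have "0 \<in> G" using conG G(2) by (metis conic_contains_0 dim_empty add_is_0 one_neq_zero)
  then have "affine hull G = span G" by (simp add: affine_hull_span_0 hull_inc)
  \<comment> \<open>A face of a convex set is its intersection with the affine hull of the face,
    here a linear span. So on the range of \<open>g\<close>, lying in \<open>G\<close> and lying in
    \<open>K\<close> are the same, and the inequalities for \<open>K\<close> alone describe the
    preimage.\<close>
  then have GL: "G = span G \<inter> K" using face_of_imp_eq_affine_Int[OF convK GK] by simp
  define G' where "G' = g -` G"
  have G'K: "G' = g -` K" unfolding G'_def
  proof (intro set_eqI, unfold vimage_eq)
    fix y
    have "g y \<in> span G" using g(3) by blast
    then show "g y \<in> G \<longleftrightarrow> g y \<in> K" using GL by blast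
  qed
  have gG': "g ` G' = G"
    using g(3) span_superset[of G] by (auto simp: G'_def image_vimage_eq)
  have conG': "conic G'"
    by (simp add: G'_def conic_def linear_cmul[OF g(1)] conicD[OF conG] del: split_paired_All)
  have dimg: "dim (g ` S) = dim S" for S :: "(real \<times> 'a) set"
    using dim_image_eq[OF g(1)] g(2) inj_on_subset by blast
  have dimG': "dim G' = DIM('a) + 1" using dimg[of G'] gG' G(2) by simp
  have nG': "\<not> G' \<subseteq> {0}" using dimG' by (metis dim_eq_0 add_is_0 one_neq_zero)
  have hull: "conic hull Q' = G'"
    using conic_hull_Int_sphere[OF conG' nG'] by (simp add: Q'_def G'_def)
  then show "conic hull Q' = g -` G" by (simp add: G'_def)
  have g0: "g y = 0 \<longleftrightarrow> y = 0" for y using g(1,2) linear_injective_0 linear_0 by metis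
  have face: "g ` H face_of K \<and> dim (g ` H) = dim H" if "H face_of G'" for H
    using that face_of_linear_image[OF g(1,2), of H G'] gG' GK dimg face_of_trans by metis
  have poly: "spherical_polytope Q'"
    unfolding spherical_polytope_def
  proof (intro conjI exI notI)
    \<comment> \<open>The normals are pulled back by the adjoint. Those orthogonal to the range of
      \<open>g\<close> become 0 and give void inequalities, so they are dropped.\<close>
    show "finite (adjoint g ` A - {0})" using A(1) by simp
    show "False" if "0 \<in> adjoint g ` A - {0}" using that by simp
    have "G' = {y. \<forall>a\<in>A. adjoint g a \<bullet> y \<le> 0}"
      using A(2) by (auto simp: G'K K_def adjoint_works[OF g(1)] inner_commute)
    also have "\<dots> = {y. \<forall>a\<in>adjoint g ` A - {0}. a \<bullet> y \<le> 0}" by force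
    finally show "Q' = sphere 0 1 \<inter> (\<Inter>a\<in>adjoint g ` A - {0}. closed_hemisphere a)"
      by (auto simp: Q'_def G'_def[symmetric] closed_hemisphere_def)
    show False if antipodal: "\<exists>x\<in>Q'. - x \<in> Q'"
    proof -
      obtain y where "y \<in> Q'" "- y \<in> Q'" using antipodal by blast
      then have "y \<in> G'" "- y \<in> G'" "norm y = 1" by (simp_all add: Q'_def G'_def)
      then have "g y \<in> conic hull Q" "- g y \<in> conic hull Q"
        by (simp_all add: G'K K_def linear_neg[OF g(1)])
      then have "g y = 0" using pointed by blast
      then show False using g0 \<open>norm y = 1\<close> by simp
    qed
  qed
  have Q'G': "Q' = G' \<inter> sphere 0 1" by (simp add: Q'_def G'_def)
  show "strongly_scribed 0 j Q'"
    unfolding strongly_scribed_def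
  proof (intro conjI allI impI)
    show "spherical_polytope_of_dim DIM('a) Q'"
      using poly hull dimG' by (simp add: spherical_polytope_of_dim_def)
  next
    fix F assume "spherical_k_face 0 F Q'"
    then obtain H where H: "H face_of G'" "dim H = 1" "F = H \<inter> sphere 0 1"
      unfolding spherical_k_face_def hull by auto
    have gH: "g ` H face_of K" "dim (g ` H) = 1" using face[OF H(1)] H(2) by auto
    have "strongly_avoids (g ` H \<inter> sphere 0 1) (K \<inter> sphere 0 1)"
      using avoid gH unfolding spherical_k_face_def K_def[symmetric] Q[symmetric] by auto
    then obtain a where a: "\<forall>x\<in>K. a \<bullet> x \<le> 0" "\<forall>x\<in>light_cone. a \<bullet> x \<le> 0"
        "g ` H = {x\<in>K. a \<bullet> x = 0}"
      using strongly_avoids_face_iff[OF conK gH(1)] gH(2) by auto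
    let ?b = "adjoint g a"
    have b: "?b \<bullet> y = a \<bullet> g y" for y by (simp add: adjoint_works[OF g(1)] inner_commute)
    have HG: "H = {y\<in>G'. ?b \<bullet> y = 0}"
    proof (intro set_eqI)
      fix y
      show "y \<in> H \<longleftrightarrow> y \<in> {y\<in>G'. ?b \<bullet> y = 0}"
        unfolding inj_image_mem_iff[OF g(2), of y H, symmetric] a(3) by (simp add: G'K b)
    qed
    \<comment> \<open>A functional vanishing on the whole span would make the ray \<open>H\<close>
      equal to \<open>G'\<close>, which has dimension at least 2.\<close>
    have "?b \<noteq> 0"
    proof
      assume "?b = 0"
      then have "H = G'" using HG by simp
      then show False using dimG' H(2) assms(5) by simp
    qed
    moreover have "\<forall>y\<in>G'. ?b \<bullet> y \<le> 0" "\<forall>y\<in>light_cone. ?b \<bullet> y \<le> 0"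
      unfolding b G'K using a(1,2) g(4) by blast+
    ultimately have "\<exists>b. b \<noteq> 0 \<and> (\<forall>y\<in>G'. b \<bullet> y \<le> 0) \<and> (\<forall>y\<in>light_cone. b \<bullet> y \<le> 0) \<and>
        H = {y\<in>G'. b \<bullet> y = 0}"
      using HG by blast
    then show "strongly_avoids F Q'"
      unfolding H(3) Q'G' using strongly_avoids_face_iff[OF conG' H(1) eq_refl[OF H(2)[symmetric]]]
      by (rule iffD2[rotated])
  next
    fix F assume "spherical_k_face j F Q'"
    then obtain H where H: "H face_of G'" "dim H = j + 1" "F = H \<inter> sphere 0 1"
      unfolding spherical_k_face_def hull by auto
    have gH: "g ` H face_of K" "dim (g ` H) = j + 1" using face[OF H(1)] H(2) by auto
    have "strongly_cuts (g ` H \<inter> sphere 0 1)"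
      using cut gH unfolding spherical_k_face_def K_def[symmetric] by auto
    then obtain x where x: "x \<in> rel_interior (g ` H)" "x \<noteq> 0" "x \<in> light_cone"
      using strongly_cuts_face_iff[OF conK gH(1)] gH(2) by auto
    obtain y where "y \<in> rel_interior H" "x = g y"
      using x(1) rel_interior_injective_linear_image[OF linear_conv_bounded_linear[THEN iffD1, OF g(1)] g(2)]
      by blast
    then show "strongly_cuts F"
      unfolding H(3) using strongly_cuts_face_iff[OF conG' H(1)] H(2) x g(4) g0
      by (metis le_add2)
  qed
qed

text \<open>Facets of \<open>G\<close> correspond to \<open>j\<close>-faces of \<open>Q\<close>, so
  two of them supply light cone points in different directions, whose sum is strictly inside the
  light cone.\<close>

lemma face_span_meets_open_light_cone:
  fixes Q :: "(real \<times> 'b::euclidean_space) set"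
  assumes "spherical_polytope Q" "Q \<noteq> {}" and G: "G face_of conic hull Q" "dim G = j + 2"
    and cut: "\<And>F. spherical_k_face j F Q \<Longrightarrow> strongly_cuts F"
  obtains u where "u \<in> span G" "norm (snd u) < fst u"
proof -
  obtain A where A: "finite A" "conic hull Q = {x. \<forall>a\<in>A. a \<bullet> x \<le> 0}"
    and pointed: "\<forall>x\<in>conic hull Q. - x \<in> conic hull Q \<longrightarrow> x = 0"
    using spherical_polytope_cone[OF assms(1,2)] by blast
  have polyG: "polyhedron G"
    using face_of_polyhedron_polyhedron G(1) polyhedron_halfspaces_at_0[OF A(1)] A(2) by metis
  have conG: "conic G" using face_of_conic G(1) conic_conic_hull by blast
  have pointedG: "x = 0" if "x \<in> G" "- x \<in> G" for x
    using that pointed face_of_imp_subset[OF G(1)] by blast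
  obtain F1 F2 where F: "F1 face_of G" "F2 face_of G" "F1 \<noteq> F2"
      "dim F1 = j + 1" "dim F2 = j + 1"
    using pointed_cone_two_facets[OF polyG conG _ pointedG] G(2) by auto
  have pt: "\<exists>x\<in>rel_interior F. x \<noteq> 0 \<and> x \<in> light_cone" if "F face_of G" "dim F = j + 1" for F
  proof -
    have FK: "F face_of conic hull Q" using that(1) G(1) face_of_trans by blast
    then have "strongly_cuts (F \<inter> sphere 0 1)"
      using cut that(2) unfolding spherical_k_face_def by blast
    then show ?thesis using strongly_cuts_face_iff[OF conic_conic_hull FK] that(2) by simp
  qed
  obtain x where x: "x \<in> rel_interior F1" "x \<noteq> 0" "x \<in> light_cone" using pt F by blast
  obtain y where y: "y \<in> rel_interior F2" "y \<noteq> 0" "y \<in> light_cone" using pt F by blast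
  \<comment> \<open>Parallel points would give the two facets a common relative interior point, and
    each facet would contain the other.\<close>
  have "y \<noteq> c *\<^sub>R x" if "c > 0" for c
  proof
    assume "y = c *\<^sub>R x"
    then have y1: "y \<in> rel_interior F1"
      using conic_rel_interior_scaleR x(1) that face_of_conic[OF conG F(1)] by blast
    have "F1 \<subseteq> F2"
      using subset_of_face_of[OF F(2) face_of_imp_subset[OF F(1)]] y y1 rel_interior_subset by blast
    moreover have "F2 \<subseteq> F1"
      using subset_of_face_of[OF F(1) face_of_imp_subset[OF F(2)]] y y1 rel_interior_subset by blast
    ultimately show False using F(3) by blast
  qed
  then have "norm (snd (x + y)) < fst (x + y)"
    using light_cone_add_strict x y by blast
  moreover have "x \<in> G" "y \<in> G"
    using x(1) y(1) F(1,2) face_of_imp_subset rel_interior_subset by blast+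
  then have "x + y \<in> span G" by (simp add: span_add span_base)
  ultimately show ?thesis using that by blast
qed

section \<open>Projective equivalence and the contradiction\<close>

lemma dim_projectively_equivalent:
  assumes "projectively_equivalent P Q"
  shows "dim (conic hull P) = dim (conic hull Q)"
proof -
  obtain f where f: "linear f" "bij_betw f (span (conic hull P)) (span (conic hull Q))"
    "f ` (conic hull P) = conic hull Q"
    using assms unfolding projectively_equivalent_def by blast
  then show ?thesis using dim_image_eq[OF f(1)] by (metis bij_betw_def)
qed

theorem proposition7p3:
  fixes d :: nat and P :: "'p::euclidean_space set"
  assumes "d \<ge> 3"
    and "DIM('a::euclidean_space) = d - 2"
    and "DIM('b::euclidean_space) = d"
    and "spherical_polytope_of_dim (d - 2) P"
    and "\<not> (\<exists>Q :: (real \<times> 'a) set. spherical_polytope_of_dim (d - 2) Q \<and>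
             projectively_equivalent Q P \<and> strongly_scribed 0 (d - 3) Q)"
  shows "\<forall>R :: 'q::euclidean_space set.
           spherical_polytope_of_dim d R \<and> stamp TYPE('b) (d - 2) R P \<longrightarrow>
           \<not> strongly_scribable TYPE('b) 0 (d - 3) R"
proof (intro allI impI notI)
  fix R :: "'q set"
  assume R: "spherical_polytope_of_dim d R \<and> stamp TYPE('b) (d - 2) R P"
    and "strongly_scribable TYPE('b) 0 (d - 3) R"
  then obtain \<phi> and Q :: "(real \<times> 'b) set"
    where real: "realization_via d \<phi> Q R" and scribed: "strongly_scribed 0 (d - 3) Q"
    using assms(3) unfolding strongly_scribable_def by auto
  have d2: "d - 2 + 2 = d" using assms(1) by simp
  obtain F where F: "spherical_face F R" "projectively_equivalent (\<phi> F) P"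
    using R real unfolding stamp_def d2 by blast
  have "spherical_face (\<phi> F) Q"
    using real F(1) unfolding realization_via_def face_lattice_isomorphism_def bij_betw_def by blast
  then obtain G where G: "G face_of conic hull Q" "\<phi> F = G \<inter> sphere 0 1"
    unfolding spherical_face_def by blast
  have dimF: "dim (conic hull (\<phi> F)) = d - 1"
    using dim_projectively_equivalent[OF F(2)] assms(1,4) by (simp add: spherical_polytope_of_dim_def)
  have conG: "conic G" using face_of_conic G(1) conic_conic_hull by blast
  \<comment> \<open>The correspondence of faces alone does not exclude the empty face; the dimension
    inherited from \<open>P\<close> does.\<close>
  have "\<not> G \<subseteq> {0}"
  proof
    assume "G \<subseteq> {0}"
    then have "\<phi> F = {}" using G(2) by auto
    then have "dim (conic hull (\<phi> F)) = 0" by simp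
    then show False using dimF assms(1) by simp
  qed
  then have hullG: "conic hull (\<phi> F) = G" using conic_hull_Int_sphere[OF conG] G(2) by simp
  \<comment> \<open>The first form matches the source \<open>real \<times> 'a\<close> of the
    parametrization; the second says that facets of \<open>G\<close> give the
    \<open>(d - 3)\<close>-faces that cut.\<close>
  have dimG: "dim G = DIM('a) + 1" "dim G = (d - 3) + 2"
    using dimF hullG assms(1,2) by simp_all
  have Q: "spherical_polytope Q" "Q \<noteq> {}"
    using scribed by (auto simp: strongly_scribed_def spherical_polytope_of_dim_def)
  have avoid: "strongly_avoids F Q" if "spherical_k_face 0 F Q" for F
    using scribed that by (simp add: strongly_scribed_def)
  have cut: "strongly_cuts F" if "spherical_k_face (d - 3) F Q" for F
    using scribed that by (simp add: strongly_scribed_def)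
  obtain u where u: "u \<in> span G" "norm (snd u) < fst u"
    using face_span_meets_open_light_cone[OF Q G(1) dimG(2) cut] by blast
  obtain g :: "real \<times> 'a \<Rightarrow> real \<times> 'b" where g: "linear g" "inj g" "range g = span G"
    "\<And>y. g y \<in> light_cone \<longleftrightarrow> y \<in> light_cone"
    using lorentzian_parametrization[OF subspace_span _ u] dimG(1) by auto
  define Q' where "Q' = (g -` G) \<inter> sphere 0 1"
  have a1: "DIM('a) \<ge> 1" using assms(1,2) by simp
  have hull: "conic hull Q' = g -` G" and scribed': "strongly_scribed 0 (d - 3) Q'"
    using face_section_scribed[OF Q G(1) dimG(1) a1 avoid cut g] unfolding Q'_def by blast+
  obtain f where f: "linear f" "bij_betw f (span G) (span (conic hull P))" "f ` G = conic hull P"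
    using F(2) hullG unfolding projectively_equivalent_def by auto
  have gG: "g ` (g -` G) = G"
    using g(3) span_superset[of G] by (auto simp: image_vimage_eq)
  have "bij_betw g (span (g -` G)) (span G)"
    using g(2) gG linear_span_image[OF g(1), of "g -` G"] by (auto simp: bij_betw_def intro: inj_on_subset)
  \<comment> \<open>Following \<open>g\<close> by the equivalence given by the stamp shows that the
    new polytope is again projectively equivalent to \<open>P\<close>.\<close>
  then have "bij_betw (f \<circ> g) (span (g -` G)) (span (conic hull P))"
    using f(2) bij_betw_trans by blast
  moreover have "(f \<circ> g) ` (g -` G) = conic hull P" using gG f(3) by (metis image_comp)
  ultimately have "projectively_equivalent Q' P"
    unfolding projectively_equivalent_def hull using linear_compose[OF g(1) f(1)] by blast
  moreover have "spherical_polytope_of_dim (d - 2) Q'"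
    using scribed' assms(2) by (simp add: strongly_scribed_def)
  ultimately show False using assms(5) scribed' by blast
qed

end
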